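(* Fix $\bar x\in\operatorname{dom}\Psi_{\mathrm w}$ and let $\Gamma$ be lower semicontinuous at $\bar x$ w.r.t. its domain $\operatorname{dom}\Gamma$. Then $\Psi_{\mathrm w}$ is closed at $\bar x$. If, additionally, $\Gamma$ is locally bounded at $\bar x$, then $\Phi_{\mathrm w}$ is closed at $\bar x$.
   Context: Setting: $f\colon\mathbb R^n\times\mathbb R^m\to\mathbb R^q$ is continuous, $\mathcal C\subset\mathbb R^q$ is a nonempty, closed, convex, pointed cone with nonempty interior, and $\Gamma\colon\mathbb R^n\rightrightarrows\mathbb R^m$ is a set-valued mapping (values may be empty) with closed graph. For $x\in\mathbb R^n$ let $f(x,A):=\{f(x,y)\mid y\in A\}$ and define $\Psi_{\mathrm w}(x):=\{y\in\Gamma(x)\mid (\{f(x,y)\}-\operatorname{int}\mathcal C)\cap f(x,\Gamma(x))=\emptyset\}$ and $\Phi_{\mathrm w}(x):=f(x,\Psi_{\mathrm w}(x))$. For a set-valued mapping $\Upsilon\colon\mathbb R^n\rightrightarrows\mathbb R^\ell$: $\operatorname{gph}\Upsilon:=\{(x,y)\mid y\in\Upsilon(x)\}$, $\operatorname{dom}\Upsilon:=\{x\mid\Upsilon(x)\neq\emptyset\}$. For $\bar x\in\operatorname{dom}\Upsilon$: $\Upsilon$ is closed at $\bar x$ if for every sequence $((x^k,y^k))_{k}\subset\operatorname{gph}\Upsilon$ with $x^k\to\bar x$ and $y^k\to\bar y$ one has $\bar y\in\Upsilon(\bar x)$; $\Upsilon$ is locally bounded at $\bar x$ if there are a bounded set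 $B$ and a neighborhood $U$ of $\bar x$ with $\Upsilon(x)\subset B$ for all $x\in U$; $\Upsilon$ is lower semicontinuous at $\bar x$ w.r.t. $\Omega\subset\mathbb R^n$ if for each open set $V$ with $\Upsilon(\bar x)\cap V\neq\emptyset$ there is a neighborhood $U$ of $\bar x$ such that $\Upsilon(x)\cap V\neq\emptyset$ for all $x\in\Omega\cap U$. *)

theory Defs
  imports "HOL-Analysis.Analysis"
begin

text \<open>A set-valued mapping is a function into sets; its values may be empty.\<close>

definition gph_sv :: "('a \<Rightarrow> 'b set) \<Rightarrow> ('a \<times> 'b) set" where
  "gph_sv Y = {(x, y). y \<in> Y x}"

definition dom_sv :: "('a \<Rightarrow> 'b set) \<Rightarrow> 'a set" where
  "dom_sv Y = {x. Y x \<noteq> {}}"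

text \<open>The following three properties are only meant for points \<open>xbar \<in> dom_sv Y\<close>;
  the membership is not part of the definitions.\<close>

definition closed_at ::
  "('a::topological_space \<Rightarrow> 'b::topological_space set) \<Rightarrow> 'a \<Rightarrow> bool" where
  "closed_at Y xbar \<longleftrightarrow>
     (\<forall>(x :: nat \<Rightarrow> 'a) (y :: nat \<Rightarrow> 'b) ybar.
        (\<forall>k. (x k, y k) \<in> gph_sv Y) \<and> x \<longlonglongrightarrow> xbar \<and> y \<longlonglongrightarrow> ybar \<longrightarrow> ybar \<in> Y xbar)"

definition locally_bounded_at ::
  "('a::topological_space \<Rightarrow> 'b::metric_space set) \<Rightarrow> 'a \<Rightarrow> bool" where
  "locally_bounded_at Y xbar \<longleftrightarrow>
     (\<exists>B U. bounded B \<and> open U \<and> xbar \<in> U \<and> (\<forall>x\<in>U. Y x \<subseteq> B))"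

definition lsc_at_wrt ::
  "('a::topological_space \<Rightarrow> 'b::topological_space set) \<Rightarrow> 'a \<Rightarrow> 'a set \<Rightarrow> bool" where
  "lsc_at_wrt Y xbar \<Omega> \<longleftrightarrow>
     (\<forall>V. open V \<and> Y xbar \<inter> V \<noteq> {} \<longrightarrow>
        (\<exists>U. open U \<and> xbar \<in> U \<and> (\<forall>x\<in>\<Omega> \<inter> U. Y x \<inter> V \<noteq> {})))"

definition pointed :: "'a::real_vector set \<Rightarrow> bool" where
  "pointed C \<longleftrightarrow> C \<inter> uminus ` C = {0}"

definition image_at :: "('a \<times> 'b \<Rightarrow> 'c) \<Rightarrow> 'a \<Rightarrow> 'b set \<Rightarrow> 'c set" where
  "image_at f x A = {f (x, y) | y. y \<in> A}"

definition Psi_w ::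
  "('a \<times> 'b \<Rightarrow> 'c::real_normed_vector) \<Rightarrow> 'c set \<Rightarrow> ('a \<Rightarrow> 'b set) \<Rightarrow> 'a \<Rightarrow> 'b set" where
  "Psi_w f C \<Gamma> x =
     {y \<in> \<Gamma> x. {f (x, y) - c | c. c \<in> interior C} \<inter> image_at f x (\<Gamma> x) = {}}"

definition Phi_w ::
  "('a \<times> 'b \<Rightarrow> 'c::real_normed_vector) \<Rightarrow> 'c set \<Rightarrow> ('a \<Rightarrow> 'b set) \<Rightarrow> 'a \<Rightarrow> 'c set" where
  "Phi_w f C \<Gamma> x = image_at f x (Psi_w f C \<Gamma> x)"

end

theory Submission
  imports Defs
begin

text \<open>Failure of weak efficiency at the limit point is witnessed by a point of \<open>\<Gamma> xbar\<close>.
  Since the interior of the cone is open and \<open>f\<close> is continuous, nearby points witness it as well,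
  and lower semicontinuity provides such points in \<open>\<Gamma> (x k)\<close> for large \<open>k\<close>. For the image mapping,
  local boundedness yields a convergent subsequence of preimages.\<close>

text \<open>Solving \<open>f (x, z) = f (x, y) - c\<close> for \<open>c\<close> turns the
  disjointness of two sets into a condition on single points \<open>z\<close>. In this form a
  violation is membership of a difference in an open set, which survives small
  perturbations.\<close>

lemma mem_Psi_w_iff:
  "y \<in> Psi_w f C \<Gamma> x \<longleftrightarrow> y \<in> \<Gamma> x \<and> (\<forall>z\<in>\<Gamma> x. f (x, y) - f (x, z) \<notin> interior C)"
proof -
  have "f (x, z) \<in> {f (x, y) - c | c. c \<in> interior C} \<longleftrightarrow> f (x, y) - f (x, z) \<in> interior C" for z
    by (simp add: eq_diff_eq conj_commute) (metis add_diff_cancel_left' diff_add_cancel)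
  then have "{f (x, y) - c | c. c \<in> interior C} \<inter> image_at f x (\<Gamma> x) = {}
      \<longleftrightarrow> (\<forall>z\<in>\<Gamma> x. f (x, y) - f (x, z) \<notin> interior C)"
    unfolding image_at_def disjoint_iff by blast
  then show ?thesis
    by (simp add: Psi_w_def)
qed

lemma closed_at_if_closed_gph_sv:
  assumes "closed (gph_sv Y)"
  shows "closed_at Y xbar"
  unfolding closed_at_def
proof (intro allI impI, elim conjE)
  fix x :: "nat \<Rightarrow> 'a" and y :: "nat \<Rightarrow> 'b" and ybar
  assume "\<forall>k. (x k, y k) \<in> gph_sv Y" and "x \<longlonglongrightarrow> xbar" and "y \<longlonglongrightarrow> ybar"
  then have "(xbar, ybar) \<in> gph_sv Y"
    using assms by (intro Lim_in_closed_set[OF _ _ _ tendsto_Pair]) auto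
  then show "ybar \<in> Y xbar"
    by (simp add: gph_sv_def)
qed

lemma closed_at_Psi_w:
  fixes f :: "'a::topological_space \<times> 'b::topological_space \<Rightarrow> 'c::real_normed_vector"
  assumes cont: "continuous_on UNIV f"
    and closed: "closed_at \<Gamma> xbar"
    and lsc: "lsc_at_wrt \<Gamma> xbar (dom_sv \<Gamma>)"
  shows "closed_at (Psi_w f C \<Gamma>) xbar"
  unfolding closed_at_def
proof (intro allI impI, elim conjE)
  fix x :: "nat \<Rightarrow> 'a" and y :: "nat \<Rightarrow> 'b" and ybar
  assume "\<forall>k. (x k, y k) \<in> gph_sv (Psi_w f C \<Gamma>)"
    and lim: "x \<longlonglongrightarrow> xbar" "y \<longlonglongrightarrow> ybar"
  then have Psi: "y k \<in> Psi_w f C \<Gamma> (x k)" for k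
    by (simp add: gph_sv_def)
  then have \<Gamma>: "y k \<in> \<Gamma> (x k)" for k
    by (simp add: mem_Psi_w_iff)
  then have "ybar \<in> \<Gamma> xbar"
    using closed lim unfolding closed_at_def gph_sv_def by blast
  moreover have "f (xbar, ybar) - f (xbar, z) \<notin> interior C" if z: "z \<in> \<Gamma> xbar" for z
  proof
    assume dom: "f (xbar, ybar) - f (xbar, z) \<in> interior C"
    \<comment> \<open>\<open>W\<close> collects the triples \<open>((x, y), z)\<close> in which
      \<open>z\<close> strictly dominates \<open>y\<close> at the parameter \<open>x\<close>. It is
      the preimage of an open set under a continuous map.\<close>
    define W where
      "W = (\<lambda>p. f (fst p) - f (fst (fst p), snd p)) -` interior C"
    have "open W"
      unfolding W_def
      by (intro open_vimage continuous_intros continuous_on_compose2[OF cont]) auto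
    moreover have "((xbar, ybar), z) \<in> W"
      using dom by (simp add: W_def)
    \<comment> \<open>A product neighbourhood separates \<open>z\<close> from \<open>(x, y)\<close>:
      lower semicontinuity needs a set \<open>V\<close> that stays fixed while \<open>x\<close>
      varies.\<close>
    ultimately obtain A V where AV: "open A" "open V" "((xbar, ybar), z) \<in> A \<times> V" "A \<times> V \<subseteq> W"
      by (rule open_prod_elim)
    then have mem: "(xbar, ybar) \<in> A" "z \<in> V"
      by simp_all
    have "\<Gamma> xbar \<inter> V \<noteq> {}"
      using z mem(2) by blast
    then obtain U where U: "open U" "xbar \<in> U" "\<forall>x\<in>dom_sv \<Gamma> \<inter> U. \<Gamma> x \<inter> V \<noteq> {}"
      using lsc[unfolded lsc_at_wrt_def, rule_format, of V] AV(2) by metis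
    have "\<forall>\<^sub>F k in sequentially. (x k, y k) \<in> A \<and> x k \<in> U"
      using topological_tendstoD[OF tendsto_Pair[OF lim] AV(1) mem(1)]
        topological_tendstoD[OF lim(1) U(1,2)]
      by (rule eventually_conj)
    then obtain k where k: "(x k, y k) \<in> A" "x k \<in> U"
      by (auto dest: eventually_happens)
    \<comment> \<open>Lower semicontinuity speaks only about points of the domain;
      \<open>y k\<close> witnesses that \<open>x k\<close> is one.\<close>
    have "x k \<in> dom_sv \<Gamma>"
      using \<Gamma>[of k] by (auto simp: dom_sv_def)
    then obtain z' where z': "z' \<in> \<Gamma> (x k)" "z' \<in> V"
      using U(3) k by blast
    then have "((x k, y k), z') \<in> W"
      using AV(4) k(1) z'(2) by blast
    then show False
      using Psi[of k] z' by (auto simp: W_def mem_Psi_w_iff)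
  qed
  ultimately show "ybar \<in> Psi_w f C \<Gamma> xbar"
    by (simp add: mem_Psi_w_iff)
qed

lemma locally_bounded_at_mono:
  assumes "locally_bounded_at Y xbar" and "\<And>x. Z x \<subseteq> Y x"
  shows "locally_bounded_at Z xbar"
  using assms unfolding locally_bounded_at_def by (meson subset_trans)

text \<open>Preimages of the \<open>w k\<close> are eventually bounded, so by Heine-Borel some
  subsequence converges. Closedness of \<open>Y\<close> puts its limit into \<open>Y xbar\<close>,
  and continuity of \<open>f\<close> with uniqueness of limits shows that this limit is mapped to
  \<open>wbar\<close>.\<close>

lemma closed_at_image_at:
  fixes f :: "'a::topological_space \<times> 'b::heine_borel \<Rightarrow> 'c::t2_space"
  assumes cont: "continuous_on UNIV f"
    and closed: "closed_at Y xbar"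
    and bdd: "locally_bounded_at Y xbar"
  shows "closed_at (\<lambda>x. image_at f x (Y x)) xbar"
  unfolding closed_at_def
proof (intro allI impI, elim conjE)
  fix x :: "nat \<Rightarrow> 'a" and w :: "nat \<Rightarrow> 'c" and wbar
  assume "\<forall>k. (x k, w k) \<in> gph_sv (\<lambda>x. image_at f x (Y x))"
    and lim: "x \<longlonglongrightarrow> xbar" "w \<longlonglongrightarrow> wbar"
  then have "\<forall>k. \<exists>y. y \<in> Y (x k) \<and> w k = f (x k, y)"
    by (auto simp: gph_sv_def image_at_def)
  then obtain y where y: "\<And>k. y k \<in> Y (x k)" "\<And>k. w k = f (x k, y k)"
    by metis
  obtain B U where BU: "bounded B" "open U" "xbar \<in> U" "\<And>x. x \<in> U \<Longrightarrow> Y x \<subseteq> B"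
    using bdd unfolding locally_bounded_at_def by blast
  obtain N where N: "\<And>k. k \<ge> N \<Longrightarrow> x k \<in> U"
    using topological_tendstoD[OF lim(1) BU(2,3)] by (auto simp: eventually_sequentially)
  \<comment> \<open>The bound \<open>B\<close> is available only once \<open>x k\<close> has entered
    \<open>U\<close>, hence the shift by \<open>N\<close>.\<close>
  have "y (k + N) \<in> B" for k
    using BU(4)[OF N[OF le_add2]] y(1) by (rule subsetD)
  then have "bounded (range (\<lambda>k. y (k + N)))"
    by (intro bounded_subset[OF BU(1)] image_subsetI)
  then obtain ybar r where r: "strict_mono (r :: nat \<Rightarrow> nat)"
    and ylim: "((\<lambda>k. y (k + N)) \<circ> r) \<longlonglongrightarrow> ybar"
    using bounded_imp_convergent_subsequence by blast
  \<comment> \<open>Shift and subsequence are merged into one strictly increasing index map, along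
    which all three sequences converge.\<close>
  define s where "s k = r k + N" for k
  have s: "strict_mono s"
    using r by (simp add: s_def strict_mono_def)
  have lims: "(\<lambda>k. x (s k)) \<longlonglongrightarrow> xbar" "(\<lambda>k. w (s k)) \<longlonglongrightarrow> wbar" "(\<lambda>k. y (s k)) \<longlonglongrightarrow> ybar"
    using LIMSEQ_subseq_LIMSEQ[OF lim(1) s] LIMSEQ_subseq_LIMSEQ[OF lim(2) s] ylim
    by (simp_all add: s_def o_def)
  have "ybar \<in> Y xbar"
    using closed[unfolded closed_at_def, rule_format, of "\<lambda>k. x (s k)" "\<lambda>k. y (s k)" ybar]
      lims(1,3) y(1) by (simp add: gph_sv_def)
  moreover have "(\<lambda>k. w (s k)) \<longlonglongrightarrow> f (xbar, ybar)"
    unfolding y(2)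
    by (rule continuous_on_tendsto_compose[OF cont tendsto_Pair[OF lims(1,3)]]) auto
  then have "wbar = f (xbar, ybar)"
    using lims(2) LIMSEQ_unique by blast
  ultimately show "wbar \<in> image_at f xbar (Y xbar)"
    by (auto simp: image_at_def)
qed

theorem lemma3p5:
  fixes f :: "(real ^ 'n) \<times> (real ^ 'm) \<Rightarrow> real ^ 'q"
    and C :: "(real ^ 'q) set"
    and \<Gamma> :: "real ^ 'n \<Rightarrow> (real ^ 'm) set"
    and xbar :: "real ^ 'n"
  assumes "continuous_on UNIV f"
    and "C \<noteq> {}" and "closed C" and "convex C" and "cone C" and "pointed C"
    and "interior C \<noteq> {}"
    and "closed (gph_sv \<Gamma>)"
    and "xbar \<in> dom_sv (Psi_w f C \<Gamma>)"
    and "lsc_at_wrt \<Gamma> xbar (dom_sv \<Gamma>)"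
  shows "closed_at (Psi_w f C \<Gamma>) xbar \<and>
         (locally_bounded_at \<Gamma> xbar \<longrightarrow> closed_at (Phi_w f C \<Gamma>) xbar)"
proof (intro conjI impI)
  show Psi: "closed_at (Psi_w f C \<Gamma>) xbar"
    using assms by (intro closed_at_Psi_w closed_at_if_closed_gph_sv)
  assume "locally_bounded_at \<Gamma> xbar"
  \<comment> \<open>The bound passes from \<open>\<Gamma>\<close> to its subsets, so the image lemma
    applies with \<open>Psi_w f C \<Gamma>\<close> as \<open>Y\<close>.\<close>
  then have "locally_bounded_at (Psi_w f C \<Gamma>) xbar"
    by (rule locally_bounded_at_mono) (simp add: Psi_w_def)
  then have "closed_at (\<lambda>x. image_at f x (Psi_w f C \<Gamma> x)) xbar"
    by (rule closed_at_image_at[OF assms(1) Psi])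
  then show "closed_at (Phi_w f C \<Gamma>) xbar"
    by (simp add: Phi_w_def[abs_def])
qed

end
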